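(* Let $k=\mathbb{Q}_p$ or $k=\mathbb{F}_p((T))$ and let $M$ be the maximum norm on $k^n$, $M(v)=\max_{1\le i\le n}|v_i|$. Let $\Lambda$ be a $p$-adic lattice of full rank in $k^n$ with dual lattice $\Lambda^*$. Suppose $\Lambda=\mathcal{L}(B)$ and $D=(B^{-1})^{\mathsf T}$ is the dual basis of $B$. If (the columns of) $B$ form an $M$-orthogonal basis of $\Lambda$, then (the columns of) $D$ form an $M$-orthogonal basis of $\Lambda^*$.
   Context: $|\cdot|$ denotes the normalized absolute value on $k$ ($|p|=p^{-1}$ on $\mathbb{Q}_p$, $|T|=p^{-1}$ on $\mathbb{F}_p((T))$), and $\mathcal{O}$ its valuation ring ($\mathbb{Z}_p$, resp. $\mathbb{F}_p[[T]]$). A $p$-adic lattice of rank $m$ in $k^n$ is $\mathcal{L}(\alpha_1,\dots,\alpha_m)=\{\sum a_i\alpha_i:a_i\in\mathcal{O}\}$ with $\alpha_1,\dots,\alpha_m\in k^n$ linearly independent over $k$; full rank means $m=n$. For a full-rank lattice $\Lambda=\mathcal{L}(B)$ with basis matrix $B$ (columns $b_1,\dots,b_n$), the dual basis is $D=(B^{-1})^{\mathsf T}$ (columns $d_i$ with $d_i^{\mathsf T}b_j=\delta_{ij}$) and the dual lattice is $\Lambda^*=\mathcal{L}(D)=\{w\in k^n:w^{\mathsf T}v\in\mathcal{O}\ \forall v\in\Lambda\}$. For a norm $N$ on $k^n$, a basis $\alpha_1,\dots,\alpha_n$ of a lattice is $N$-orthogonal if $N(\sum_{i=1}^n a_i\alpha_i)=\max_{1\le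 i\le n}N(a_i\alpha_i)$ for all $a_1,\dots,a_n\in k$. *)

theory Defs
  imports
    "HOL-Analysis.Analysis"
    "HOL-Computational_Algebra.Fraction_Field"
    "HOL-Computational_Algebra.Formal_Laurent_Series"
    "Berlekamp_Zassenhaus.Finite_Field"
begin

unbundle no fps_syntax  (* its $ clashes with vector components *)

section \<open>The field of p-adic numbers\<close>

text \<open>The prime is p = CARD('p) for a type 'p of class prime_card. The p-adic integers are the
  inverse limit of the rings Z/p^n; an element is the coherent sequence of its residues modulo
  p^n, each represented in {0..<p^n}.\<close>

typedef (overloaded) ('p::prime_card) padic_int =
  "{f :: nat \<Rightarrow> int. \<forall>n. f n = f (Suc n) mod int CARD('p) ^ n}"
  by (rule exI[of _ "\<lambda>_. 0"]) simp

setup_lifting type_definition_padic_int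

lemma mod_mod_power_Suc: "a mod (p::int) ^ Suc n mod p ^ n = a mod p ^ n"
  by (rule mod_mod_cancel) simp

instantiation padic_int :: (prime_card) comm_ring_1
begin

lift_definition zero_padic_int :: "'a padic_int" is "\<lambda>_. 0" by simp

lift_definition one_padic_int :: "'a padic_int" is "\<lambda>n. 1 mod int CARD('a) ^ n"
  by (simp only: mod_mod_power_Suc simp_thms)

lift_definition plus_padic_int :: "'a padic_int \<Rightarrow> 'a padic_int \<Rightarrow> 'a padic_int"
  is "\<lambda>f g n. (f n + g n) mod int CARD('a) ^ n"
proof -
  fix f g :: "nat \<Rightarrow> int" and n
  assume *: "\<And>n. f n = f (Suc n) mod int CARD('a) ^ n"
    and **: "\<And>n. g n = g (Suc n) mod int CARD('a) ^ n"
  have "f n = f (Suc n) mod int CARD('a) ^ n" "g n = g (Suc n) mod int CARD('a) ^ n"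
    by (rule * **)+
  then show "(f n + g n) mod int CARD('a) ^ n =
      (f (Suc n) + g (Suc n)) mod int CARD('a) ^ Suc n mod int CARD('a) ^ n"
    by (simp only: mod_mod_power_Suc mod_add_eq)
qed

lift_definition times_padic_int :: "'a padic_int \<Rightarrow> 'a padic_int \<Rightarrow> 'a padic_int"
  is "\<lambda>f g n. (f n * g n) mod int CARD('a) ^ n"
proof -
  fix f g :: "nat \<Rightarrow> int" and n
  assume *: "\<And>n. f n = f (Suc n) mod int CARD('a) ^ n"
    and **: "\<And>n. g n = g (Suc n) mod int CARD('a) ^ n"
  have "f n = f (Suc n) mod int CARD('a) ^ n" "g n = g (Suc n) mod int CARD('a) ^ n"
    by (rule * **)+
  then show "(f n * g n) mod int CARD('a) ^ n =
      (f (Suc n) * g (Suc n)) mod int CARD('a) ^ Suc n mod int CARD('a) ^ n"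
    by (simp only: mod_mod_power_Suc mod_mult_eq)
qed

lift_definition uminus_padic_int :: "'a padic_int \<Rightarrow> 'a padic_int"
  is "\<lambda>f n. (- f n) mod int CARD('a) ^ n"
proof -
  fix f :: "nat \<Rightarrow> int" and n
  assume *: "\<And>n. f n = f (Suc n) mod int CARD('a) ^ n"
  have "f n = f (Suc n) mod int CARD('a) ^ n" by (rule *)
  then show "(- f n) mod int CARD('a) ^ n =
      (- f (Suc n)) mod int CARD('a) ^ Suc n mod int CARD('a) ^ n"
    by (simp only: mod_mod_power_Suc mod_minus_eq)
qed

lift_definition minus_padic_int :: "'a padic_int \<Rightarrow> 'a padic_int \<Rightarrow> 'a padic_int"
  is "\<lambda>f g n. (f n - g n) mod int CARD('a) ^ n"
proof -
  fix f g :: "nat \<Rightarrow> int" and n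
  assume *: "\<And>n. f n = f (Suc n) mod int CARD('a) ^ n"
    and **: "\<And>n. g n = g (Suc n) mod int CARD('a) ^ n"
  have "f n = f (Suc n) mod int CARD('a) ^ n" "g n = g (Suc n) mod int CARD('a) ^ n"
    by (rule * **)+
  then show "(f n - g n) mod int CARD('a) ^ n =
      (f (Suc n) - g (Suc n)) mod int CARD('a) ^ Suc n mod int CARD('a) ^ n"
    by (simp only: mod_mod_power_Suc mod_diff_eq)
qed

instance
proof
  have red: "Rep_padic_int x n mod int CARD('a) ^ n = Rep_padic_int x n" for x :: "'a padic_int" and n
    using Rep_padic_int[of x] by (metis (mono_tags, lifting) mem_Collect_eq mod_mod_trivial)
  note eqI = iffD1[OF Rep_padic_int_inject, OF ext]
  note rep = plus_padic_int.rep_eq times_padic_int.rep_eq uminus_padic_int.rep_eq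
    minus_padic_int.rep_eq zero_padic_int.rep_eq one_padic_int.rep_eq
  fix a b c :: "'a padic_int"
  show "a * b * c = a * (b * c)"
    by (rule eqI) (simp add: rep mod_mult_left_eq mod_mult_right_eq mult.assoc)
  show "a * b = b * a"
    by (rule eqI) (simp add: rep mult.commute)
  show "1 * a = a"
    by (rule eqI) (simp add: rep mod_mult_left_eq red)
  show "a + b + c = a + (b + c)"
    by (rule eqI) (simp add: rep mod_add_left_eq mod_add_right_eq add.assoc)
  show "a + b = b + a"
    by (rule eqI) (simp add: rep add.commute)
  show "0 + a = a"
    by (rule eqI) (simp add: rep red)
  show "- a + a = 0"
    by (rule eqI) (simp add: rep mod_add_left_eq)
  show "a - b = a + - b"
    by (rule eqI) (simp add: rep mod_add_right_eq)
  show "(a + b) * c = a * c + b * c"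
    by (rule eqI) (simp add: rep mod_mult_left_eq mod_add_eq distrib_right)
  have "Rep_padic_int (1 :: 'a padic_int) 1 = 1"
    using prime_gt_1_nat[OF prime_card[where 'a='a]] by (simp add: rep)
  then show "(0 :: 'a padic_int) \<noteq> 1"
    by (metis zero_neq_one zero_padic_int.rep_eq)
qed

end

text \<open>For nonzero x, the largest n such that p^n divides x.\<close>

definition padic_int_val :: "'p::prime_card padic_int \<Rightarrow> nat" where
  "padic_int_val x = (LEAST n. Rep_padic_int x (Suc n) \<noteq> 0)"

definition padic_int_abs :: "'p::prime_card padic_int \<Rightarrow> real" where
  "padic_int_abs x = (if x = 0 then 0 else 1 / real CARD('p) ^ padic_int_val x)"

lemma Rep_padic_int_Suc:
  "Rep_padic_int (x :: 'p::prime_card padic_int) n = Rep_padic_int x (Suc n) mod int CARD('p) ^ n"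
  using Rep_padic_int[of x] by blast

lemma Rep_padic_int_mod:
  fixes x :: "'p::prime_card padic_int"
  assumes "n \<le> m"
  shows "Rep_padic_int x m mod int CARD('p) ^ n = Rep_padic_int x n"
  using assms
proof (induction m rule: dec_induct)
  case base
  have "Rep_padic_int x n = Rep_padic_int x (Suc n) mod int CARD('p) ^ n"
    by (rule Rep_padic_int_Suc)
  then show ?case by (simp only: mod_mod_trivial)
next
  case (step m)
  have "int CARD('p) ^ n dvd int CARD('p) ^ m"
    using step.hyps by (simp add: le_imp_power_dvd)
  then have "Rep_padic_int x (Suc m) mod int CARD('p) ^ n
      = Rep_padic_int x (Suc m) mod int CARD('p) ^ m mod int CARD('p) ^ n"
    by (rule mod_mod_cancel[symmetric])
  also have "\<dots> = Rep_padic_int x n"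
    by (simp only: Rep_padic_int_Suc[symmetric] step.IH)
  finally show ?case .
qed

lemma Rep_padic_int_eq_0_iff:
  fixes x :: "'p::prime_card padic_int"
  assumes "n \<le> m"
  shows "Rep_padic_int x n = 0 \<longleftrightarrow> int CARD('p) ^ n dvd Rep_padic_int x m"
  using Rep_padic_int_mod[OF assms, of x] by (simp add: dvd_eq_mod_eq_0)

lemma padic_int_val_iff:
  fixes x :: "'p::prime_card padic_int"
  assumes "x \<noteq> 0"
  shows "Rep_padic_int x n = 0 \<longleftrightarrow> n \<le> padic_int_val x"
proof -
  let ?R = "Rep_padic_int x" and ?v = "padic_int_val x"
  have zero: "?R 0 = 0"
    using Rep_padic_int_Suc[of x 0] by (simp only: power_0 mod_by_1)
  have "\<exists>k. ?R (Suc k) \<noteq> 0"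
  proof (rule ccontr)
    assume "\<not> (\<exists>k. ?R (Suc k) \<noteq> 0)"
    with zero have "?R k = 0" for k by (cases k) auto
    then have "?R = Rep_padic_int (0 :: 'p padic_int)" by (intro ext) (simp only: zero_padic_int.rep_eq)
    with assms show False by (simp add: Rep_padic_int_inject)
  qed
  then have nz: "?R (Suc ?v) \<noteq> 0"
    unfolding padic_int_val_def by (rule LeastI_ex)
  show ?thesis
  proof
    assume n: "?R n = 0"
    show "n \<le> ?v"
    proof (rule ccontr)
      assume "\<not> n \<le> ?v"
      then have "?R n mod int CARD('p) ^ Suc ?v = ?R (Suc ?v)"
        by (intro Rep_padic_int_mod) simp
      with n nz show False by (simp only: mod_0 simp_thms)
    qed
  next
    assume n: "n \<le> ?v"
    show "?R n = 0"
    proof (cases n)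
      case 0
      then show ?thesis by (simp only: zero)
    next
      case (Suc k)
      then have "k < ?v" using n by simp
      then have "\<not> ?R (Suc k) \<noteq> 0"
        unfolding padic_int_val_def by (rule not_less_Least)
      then show ?thesis using Suc by simp
    qed
  qed
qed

lemma padic_int_val_multiplicity:
  fixes x :: "'p::prime_card padic_int"
  assumes "x \<noteq> 0" "padic_int_val x < m"
  shows "Rep_padic_int x m \<noteq> 0 \<and> multiplicity (int CARD('p)) (Rep_padic_int x m) = padic_int_val x"
proof
  show "Rep_padic_int x m \<noteq> 0" using assms padic_int_val_iff[of x m] by simp
  have 1: "int CARD('p) ^ padic_int_val x dvd Rep_padic_int x m"
    using Rep_padic_int_eq_0_iff[of "padic_int_val x" m x] padic_int_val_iff[of x "padic_int_val x"]
      assms by simp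
  have 2: "\<not> int CARD('p) ^ Suc (padic_int_val x) dvd Rep_padic_int x m"
    using Rep_padic_int_eq_0_iff[of "Suc (padic_int_val x)" m x]
      padic_int_val_iff[of x "Suc (padic_int_val x)"] assms by simp
  show "multiplicity (int CARD('p)) (Rep_padic_int x m) = padic_int_val x"
    using 1 2 by (intro multiplicity_eqI) auto
qed

lemma padic_int_val_mult_aux:
  fixes x y :: "'p::prime_card padic_int"
  assumes "x \<noteq> 0" "y \<noteq> 0"
  shows "Rep_padic_int (x * y) n = 0 \<longleftrightarrow> n \<le> padic_int_val x + padic_int_val y"
proof -
  define m where "m = n + padic_int_val x + padic_int_val y + 1"
  let ?X = "Rep_padic_int x m" and ?Y = "Rep_padic_int y m" and ?p = "int CARD('p)"
  have p: "prime ?p" using prime_card[where 'a='p] by simp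
  have X: "?X \<noteq> 0" "multiplicity ?p ?X = padic_int_val x"
    using padic_int_val_multiplicity[OF assms(1), of m] by (auto simp: m_def)
  have Y: "?Y \<noteq> 0" "multiplicity ?p ?Y = padic_int_val y"
    using padic_int_val_multiplicity[OF assms(2), of m] by (auto simp: m_def)
  have "Rep_padic_int (x * y) n = Rep_padic_int (x * y) m mod ?p ^ n"
    by (rule Rep_padic_int_mod[symmetric]) (simp add: m_def)
  also have "\<dots> = (?X * ?Y) mod ?p ^ n"
    unfolding times_padic_int.rep_eq
    by (rule mod_mod_cancel) (simp add: m_def le_imp_power_dvd)
  finally have "Rep_padic_int (x * y) n = 0 \<longleftrightarrow> ?p ^ n dvd ?X * ?Y"
    by (simp add: dvd_eq_mod_eq_0)
  also have "\<dots> \<longleftrightarrow> n \<le> multiplicity ?p (?X * ?Y)"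
    using p X(1) Y(1) by (intro power_dvd_iff_le_multiplicity) auto
  also have "multiplicity ?p (?X * ?Y) = padic_int_val x + padic_int_val y"
    using p X Y by (subst prime_elem_multiplicity_mult_distrib) auto
  finally show ?thesis .
qed

instance padic_int :: (prime_card) idom
proof
  fix a b :: "'a padic_int"
  assume "a \<noteq> 0" "b \<noteq> 0"
  then have "Rep_padic_int (a * b) (Suc (padic_int_val a + padic_int_val b)) \<noteq> 0"
    using padic_int_val_mult_aux[of a b "Suc (padic_int_val a + padic_int_val b)"] by simp
  then show "a * b \<noteq> 0" by (auto simp: zero_padic_int.rep_eq)
qed

lemma padic_int_val_mult:
  fixes x y :: "'p::prime_card padic_int"
  assumes "x \<noteq> 0" "y \<noteq> 0"
  shows "padic_int_val (x * y) = padic_int_val x + padic_int_val y"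
proof -
  have "x * y \<noteq> 0" using assms by simp
  then have "n \<le> padic_int_val (x * y) \<longleftrightarrow> n \<le> padic_int_val x + padic_int_val y" for n
    using padic_int_val_iff[of "x * y" n] padic_int_val_mult_aux[OF assms, of n] by simp
  then show ?thesis by (metis le_antisym order_refl)
qed

lemma padic_int_abs_mult:
  "padic_int_abs (x * y) = padic_int_abs x * padic_int_abs y"
  by (simp add: padic_int_abs_def padic_int_val_mult power_add)

lemma padic_int_abs_eq_0_iff [simp]: "padic_int_abs x = 0 \<longleftrightarrow> x = 0"
  by (simp add: padic_int_abs_def)

type_synonym 'p padic = "'p padic_int fract"

definition padic_abs :: "'p::prime_card padic \<Rightarrow> real" where
  "padic_abs x =
     (THE r. \<exists>a b. b \<noteq> 0 \<and> x = Fract a b \<and> r = padic_int_abs a / padic_int_abs b)"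

lemma padic_abs_Fract:
  assumes "b \<noteq> 0"
  shows "padic_abs (Fract a b) = padic_int_abs a / padic_int_abs b"
  unfolding padic_abs_def
proof (rule the_equality)
  show "\<exists>a' b'. b' \<noteq> 0 \<and> Fract a b = Fract a' b'
          \<and> padic_int_abs a / padic_int_abs b = padic_int_abs a' / padic_int_abs b'"
    using assms by blast
next
  fix r assume "\<exists>a' b'. b' \<noteq> 0 \<and> Fract a b = Fract a' b'
                  \<and> r = padic_int_abs a' / padic_int_abs b'"
  then obtain a' b' where *: "b' \<noteq> 0" "Fract a b = Fract a' b'"
    "r = padic_int_abs a' / padic_int_abs b'" by blast
  then have "padic_int_abs (a * b') = padic_int_abs (a' * b)"
    using assms by (simp add: eq_fract)
  then show "r = padic_int_abs a / padic_int_abs b"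
    using *(1,3) assms by (simp add: padic_int_abs_mult frac_eq_eq)
qed

lemma Rep_padic_int_of_nat:
  "Rep_padic_int (of_nat k :: 'p::prime_card padic_int) n = int k mod int CARD('p) ^ n"
proof (induction k)
  case (Suc k)
  then show ?case
    by (simp add: plus_padic_int.rep_eq one_padic_int.rep_eq mod_add_eq)
qed (simp add: zero_padic_int.rep_eq)

lemma padic_abs_of_CARD: "padic_abs (of_nat CARD('p) :: 'p::prime_card padic) = 1 / real CARD('p)"
proof -
  let ?x = "of_nat CARD('p) :: 'p padic_int" and ?p = "int CARD('p)"
  have p: "?p > 1" using prime_gt_1_nat[OF prime_card[where 'a='p]] by simp
  have 1: "Rep_padic_int ?x 1 = 0" by (simp add: Rep_padic_int_of_nat)
  have "?p < ?p ^ 2" using power_strict_increasing[of 1 2 ?p] p by simp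
  then have 2: "Rep_padic_int ?x 2 \<noteq> 0"
    unfolding Rep_padic_int_of_nat using p by (subst mod_pos_pos_trivial) auto
  then have x: "?x \<noteq> 0" by (metis zero_padic_int.rep_eq)
  have "padic_int_val ?x = 1"
    using padic_int_val_iff[OF x, of 1] padic_int_val_iff[OF x, of 2] 1 2 by simp
  moreover have one: "padic_int_val (1 :: 'p padic_int) = 0"
    using padic_int_val_mult[of 1 "1 :: 'p padic_int"] by simp
  ultimately show ?thesis
    using x by (simp add: of_nat_fract padic_abs_Fract padic_int_abs_def)
qed


section \<open>The field of Laurent series over the prime field\<close>

type_synonym 'p fp_laurent = "'p mod_ring fls"

definition fp_laurent_abs :: "'p::prime_card fp_laurent \<Rightarrow> real" where
  "fp_laurent_abs f = (if f = 0 then 0 else real CARD('p) powi (- fls_subdegree f))"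

lemma fp_laurent_abs_X: "fp_laurent_abs (fls_X :: 'p::prime_card fp_laurent) = 1 / real CARD('p)"
  by (simp add: fp_laurent_abs_def power_int_minus divide_inverse)


section \<open>Lattices and orthogonal bases\<close>

text \<open>Throughout, nv is the absolute value of the ground field. A basis is a family of vectors
  indexed by a finite type; for a matrix B the family of its columns is (\<lambda>j. column j B).\<close>

definition valuation_ring :: "('k \<Rightarrow> real) \<Rightarrow> 'k set" where
  "valuation_ring nv = {x. nv x \<le> 1}"

definition max_norm :: "('k \<Rightarrow> real) \<Rightarrow> 'k ^ 'n \<Rightarrow> real" where
  "max_norm nv v = Max (range (\<lambda>i. nv (v $ i)))"

definition lin_indep_family :: "('m \<Rightarrow> 'k::field ^ 'n) \<Rightarrow> bool" where
  "lin_indep_family \<alpha> \<longleftrightarrow> inj \<alpha> \<and> vec.independent (range \<alpha>)"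

definition lattice_span :: "('k \<Rightarrow> real) \<Rightarrow> ('m::finite \<Rightarrow> 'k::field ^ 'n) \<Rightarrow> ('k ^ 'n) set" where
  "lattice_span nv \<alpha> = {\<Sum>i\<in>UNIV. a i *s \<alpha> i |a. \<forall>i. a i \<in> valuation_ring nv}"

definition lattice_basis ::
  "('k \<Rightarrow> real) \<Rightarrow> ('k::field ^ 'n) set \<Rightarrow> ('m::finite \<Rightarrow> 'k ^ 'n) \<Rightarrow> bool" where
  "lattice_basis nv \<Lambda> \<alpha> \<longleftrightarrow> lin_indep_family \<alpha> \<and> \<Lambda> = lattice_span nv \<alpha>"

definition full_rank_lattice :: "('k \<Rightarrow> real) \<Rightarrow> ('k::field ^ 'n) set \<Rightarrow> bool" where
  "full_rank_lattice nv \<Lambda> \<longleftrightarrow> (\<exists>\<alpha> :: 'n \<Rightarrow> 'k ^ 'n. lattice_basis nv \<Lambda> \<alpha>)"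

definition dual_lattice :: "('k \<Rightarrow> real) \<Rightarrow> ('k::field ^ 'n) set \<Rightarrow> ('k ^ 'n) set" where
  "dual_lattice nv \<Lambda> = {w. \<forall>v\<in>\<Lambda>. (\<Sum>i\<in>UNIV. w $ i * v $ i) \<in> valuation_ring nv}"

definition orthogonal_basis ::
  "('k \<Rightarrow> real) \<Rightarrow> ('k ^ 'n \<Rightarrow> real) \<Rightarrow> ('k::field ^ 'n) set \<Rightarrow> ('n \<Rightarrow> 'k ^ 'n) \<Rightarrow> bool" where
  "orthogonal_basis nv N \<Lambda> \<alpha> \<longleftrightarrow>
     lattice_basis nv \<Lambda> \<alpha> \<and>
     (\<forall>a. N (\<Sum>i\<in>UNIV. a i *s \<alpha> i) = Max (range (\<lambda>i. N (a i *s \<alpha> i))))"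

end

theory Submission
  imports Defs
begin

text \<open>Write x \<bullet> y for the standard bilinear form on k^n. Expanding the unit vectors e_l in an orthogonal
  basis b_i gives \<bar>d_i $ l\<bar> M(b_i) \<le> M(e_l) = 1, that is, M(d_i) M(b_i) \<le> 1. If w is the
  combination of the d_i with coefficients a_i, then a_i = w \<bullet> b_i, so
  \<bar>a_i\<bar> \<le> M(w) M(b_i) by the ultrametric inequality, and hence \<bar>a_i\<bar> M(d_i) \<le> M(w). The
  reverse bound M(w) \<le> max \<bar>a_i\<bar> M(d_i) is the ultrametric inequality again.\<close>

section \<open>Ultrametric absolute values and the maximum norm\<close>

locale nonarch_abs =
  fixes nv :: "'k::field \<Rightarrow> real"
  assumes nv_nonneg: "0 \<le> nv x"
    and nv_eq_0_iff [simp]: "nv x = 0 \<longleftrightarrow> x = 0"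
    and nv_mult: "nv (x * y) = nv x * nv y"
    and nv_add_le_max: "nv (x + y) \<le> max (nv x) (nv y)"
begin

lemma nv_0 [simp]: "nv 0 = 0"
  by simp

lemma nv_1 [simp]: "nv 1 = 1"
  using nv_mult[of 1 1] nv_eq_0_iff[of 1] by simp

text \<open>A uniform bound \<open>c\<close> stands in for the maximum over the summands, and
  \<open>0 \<le> c\<close> covers the empty sum.\<close>

lemma nv_sum_le:
  assumes "finite S" "0 \<le> c" "\<And>i. i \<in> S \<Longrightarrow> nv (f i) \<le> c"
  shows "nv (\<Sum>i\<in>S. f i) \<le> c"
  using assms(1,3)
proof (induction S rule: finite_induct)
  case empty
  show ?case using assms(2) by simp
next
  case (insert x S)
  then have "nv (f x) \<le> c" "nv (\<Sum>i\<in>S. f i) \<le> c" by auto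
  then show ?case using insert.hyps nv_add_le_max[of "f x" "\<Sum>i\<in>S. f i"] by simp
qed

lemma sum_mult_in_valuation_ring:
  assumes "\<And>i. a i \<in> valuation_ring nv" "\<And>i. b i \<in> valuation_ring nv"
  shows "(\<Sum>i\<in>(UNIV :: 'n::finite set). a i * b i) \<in> valuation_ring nv"
  using assms by (auto simp: valuation_ring_def nv_mult nv_nonneg intro!: nv_sum_le mult_le_one)

lemma nv_le_max_norm: "nv (v $ i) \<le> max_norm nv v"
  by (simp add: max_norm_def)

lemma max_norm_le_iff: "max_norm nv v \<le> c \<longleftrightarrow> (\<forall>i. nv (v $ i) \<le> c)"
  by (auto simp: max_norm_def)

lemma max_norm_nonneg: "0 \<le> max_norm nv v"
  using nv_nonneg nv_le_max_norm order_trans by blast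

lemma max_norm_pos: "v \<noteq> 0 \<Longrightarrow> 0 < max_norm nv v"
  using nv_le_max_norm[of v] nv_nonneg by (metis vec_eq_iff less_le order.trans nv_eq_0_iff zero_index
    max_norm_nonneg order_antisym)

lemma max_norm_axis: "max_norm nv (axis l 1) \<le> 1"
  by (auto simp: max_norm_le_iff axis_def)

text \<open>Multiplication by the nonnegative number \<open>nv c\<close> is monotone, so it commutes
  with the maximum.\<close>

lemma max_norm_smult: "max_norm nv (c *s v) = nv c * max_norm nv v"
proof -
  have "range (\<lambda>i. nv ((c *s v) $ i)) = (*) (nv c) ` range (\<lambda>i. nv (v $ i))"
    by (auto simp: nv_mult)
  moreover have "mono ((*) (nv c))"
    by (auto intro!: monoI mult_left_mono nv_nonneg)
  ultimately show ?thesis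
    unfolding max_norm_def by (simp add: mono_Max_commute)
qed

text \<open>An ultrametric Cauchy-Schwarz inequality: each single product already satisfies the
  bound, and the sum inherits it.\<close>

lemma nv_dot_le: "nv (\<Sum>l\<in>UNIV. v $ l * w $ l) \<le> max_norm nv v * max_norm nv w"
  by (auto intro!: nv_sum_le mult_mono nv_le_max_norm
      simp: nv_mult nv_nonneg max_norm_nonneg)

lemma max_norm_sum_le:
  fixes f :: "'i::finite \<Rightarrow> 'k ^ 'n"
  assumes "\<And>i. max_norm nv (f i) \<le> c"
  shows "max_norm nv (\<Sum>i\<in>UNIV. f i) \<le> c"
proof -
  \<comment> \<open>The index type is nonempty, so \<open>c\<close> bounds at least one
    norm.\<close>
  have "0 \<le> c" using max_norm_nonneg assms order_trans by blast
  then show ?thesis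
    using assms by (auto simp: max_norm_le_iff intro!: nv_sum_le)
qed

end

section \<open>Linear independence and invertible matrices\<close>

lemma lin_indep_family_iff:
  fixes \<alpha> :: "'m::finite \<Rightarrow> 'k::field ^ 'n"
  shows "lin_indep_family \<alpha> \<longleftrightarrow> (\<forall>a. (\<Sum>i\<in>UNIV. a i *s \<alpha> i) = 0 \<longrightarrow> (\<forall>i. a i = 0))"
proof
  assume "lin_indep_family \<alpha>"
  then have inj: "inj \<alpha>" and ind: "vec.independent (range \<alpha>)"
    by (auto simp: lin_indep_family_def)
  show "\<forall>a. (\<Sum>i\<in>UNIV. a i *s \<alpha> i) = 0 \<longrightarrow> (\<forall>i. a i = 0)"
  proof (intro allI impI)
    fix a i assume a: "(\<Sum>i\<in>UNIV. a i *s \<alpha> i) = 0"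
    \<comment> \<open>Independence is a property of the set \<open>range \<alpha>\<close>, so the
      coefficients are carried from indices to vectors along the inverse of
      \<open>\<alpha>\<close>.\<close>
    have "(\<Sum>v\<in>range \<alpha>. a (the_inv \<alpha> v) *s v) = 0"
      using a inj by (simp add: sum.reindex the_inv_f_f)
    then have "a (the_inv \<alpha> (\<alpha> i)) = 0"
      using vec.independentD[OF ind, of "range \<alpha>" "\<lambda>v. a (the_inv \<alpha> v)"] by auto
    then show "a i = 0" using inj by (simp add: the_inv_f_f)
  qed
next
  assume *: "\<forall>a. (\<Sum>i\<in>UNIV. a i *s \<alpha> i) = 0 \<longrightarrow> (\<forall>i. a i = 0)"
  have inj: "inj \<alpha>"
  proof (rule injI, rule ccontr)
    fix i j assume ij: "\<alpha> i = \<alpha> j" "i \<noteq> j"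
    \<comment> \<open>If two indices carry the same vector, coefficients 1 and -1 at these indices
      give a nontrivial relation.\<close>
    define a :: "'m \<Rightarrow> 'k" where "a = (\<lambda>l. (if l = i then 1 else 0) - (if l = j then 1 else 0))"
    have "(\<Sum>l\<in>UNIV. a l *s \<alpha> l) =
        (\<Sum>l\<in>UNIV. if l = i then \<alpha> l else 0) - (\<Sum>l\<in>UNIV. if l = j then \<alpha> l else 0)"
      unfolding sum_subtractf[symmetric]
      by (rule sum.cong) (auto simp: a_def vec.scale_left_diff_distrib)
    then have "(\<Sum>l\<in>UNIV. a l *s \<alpha> l) = 0" using ij by simp
    with * have "a i = 0" by blast
    then show False using ij by (simp add: a_def)
  qed
  moreover have "vec.independent (range \<alpha>)"
  proof
    assume "vec.dependent (range \<alpha>)"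
    then obtain u v where "v \<in> range \<alpha>" "u v \<noteq> 0" "(\<Sum>v\<in>range \<alpha>. u v *s v) = 0"
      by (subst (asm) vec.dependent_finite) auto
    moreover from this(3) inj have "(\<Sum>i\<in>UNIV. u (\<alpha> i) *s \<alpha> i) = 0"
      by (simp add: sum.reindex)
    ultimately show False using * by (auto dest!: spec[of _ "\<lambda>i. u (\<alpha> i)"])
  qed
  ultimately show "lin_indep_family \<alpha>" by (simp add: lin_indep_family_def)
qed

lemma lin_indep_family_columns_iff:
  fixes B :: "'k::field ^ 'n ^ 'n"
  shows "lin_indep_family (\<lambda>j. column j B) \<longleftrightarrow> invertible B"
  unfolding lin_indep_family_iff invertible_left_inverse
  by (rule matrix_left_invertible_independent_columns[symmetric])

lemma sum_scale_column:
  fixes A :: "'k::field ^ 'n ^ 'm"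
  shows "(\<Sum>i\<in>UNIV. a i *s column i A) = A *v (\<chi> i. a i)"
  by (simp add: vec_eq_iff matrix_vector_mult_def column_def mult.commute)

section \<open>Dual bases and dual lattices\<close>

lemma matrix_mult_matrix_inv:
  fixes B :: "'k::field ^ 'n ^ 'n"
  assumes "invertible B"
  shows "B ** matrix_inv B = mat 1" "matrix_inv B ** B = mat 1"
  using assms unfolding matrix_inv_def invertible_def
  by (metis (mono_tags, lifting) someI_ex)+

text \<open>The entries of the first product are the pairings of the b_i with the d_j, so it encodes
  biorthogonality. The second product yields the expansion of an arbitrary vector in the
  d_i.\<close>

lemma transpose_mult_dual:
  fixes B :: "'k::field ^ 'n ^ 'n"
  assumes "invertible B"
  shows "transpose B ** transpose (matrix_inv B) = mat 1"
    "transpose (matrix_inv B) ** transpose B = mat 1"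
  using matrix_mult_matrix_inv[OF assms] by (simp_all add: matrix_transpose_mul[symmetric])

text \<open>By biorthogonality, pairing with b_j kills every d_i with i different from j.\<close>

lemma dual_basis_coefficient:
  fixes B :: "'k::field ^ 'n ^ 'n"
  assumes "invertible B"
  shows "(\<Sum>l\<in>UNIV. (\<Sum>i\<in>UNIV. a i *s column i (transpose (matrix_inv B))) $ l * column j B $ l) = a j"
proof -
  let ?D = "transpose (matrix_inv B)"
  have "(\<Sum>l\<in>UNIV. (\<Sum>i\<in>UNIV. a i *s column i ?D) $ l * column j B $ l)
      = (transpose B *v (?D *v (\<chi> i. a i))) $ j"
    unfolding sum_scale_column
    by (simp add: matrix_vector_mult_def transpose_def column_def mult.commute)
  also have "\<dots> = a j"
    by (simp only: matrix_vector_mul_assoc transpose_mult_dual[OF assms] matrix_vector_mul_lid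
        vec_lambda_beta)
  finally show ?thesis .
qed

text \<open>The coordinates of w in the basis d_i are the pairings w \<bullet> b_i. Integral
  pairings with the lattice therefore amount to integral coordinates.\<close>

lemma (in nonarch_abs) dual_lattice_span_columns:
  fixes B :: "'k ^ 'n ^ 'n"
  assumes "invertible B"
  shows "dual_lattice nv (lattice_span nv (\<lambda>j. column j B)) =
    lattice_span nv (\<lambda>j. column j (transpose (matrix_inv B)))"
proof -
  let ?D = "transpose (matrix_inv B)"
  let ?dot = "\<lambda>v w :: 'k ^ 'n. \<Sum>l\<in>UNIV. v $ l * w $ l"
  have dot: "?dot w (\<Sum>i\<in>UNIV. a i *s column i B) = (\<Sum>i\<in>UNIV. a i * ?dot w (column i B))"
    for w a
    unfolding sum_component vector_smult_component sum_distrib_left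
    by (subst sum.swap) (simp add: mult_ac)
  have dual: "(\<Sum>i\<in>UNIV. ?dot w (column i B) *s column i ?D) = w" for w
  proof -
    have "(\<Sum>i\<in>UNIV. ?dot w (column i B) *s column i ?D) = ?D *v (transpose B *v w)"
      unfolding sum_scale_column
      by (rule arg_cong[of _ _ "(*v) ?D"])
        (simp add: vec_eq_iff matrix_vector_mult_def transpose_def column_def mult.commute)
    also have "\<dots> = w"
      by (simp only: matrix_vector_mul_assoc transpose_mult_dual[OF assms] matrix_vector_mul_lid)
    finally show ?thesis .
  qed
  show ?thesis
  proof (intro equalityI subsetI)
    fix w assume w: "w \<in> dual_lattice nv (lattice_span nv (\<lambda>j. column j B))"
    \<comment> \<open>The coefficients 0 and 1 are integral, so w may be tested on each basis
      vector.\<close>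
    have "column i B \<in> lattice_span nv (\<lambda>j. column j B)" for i
      unfolding lattice_span_def
      by (rule CollectI, rule exI[of _ "\<lambda>j. if j = i then 1 else 0"])
        (simp add: valuation_ring_def if_distrib[of "\<lambda>c. c *s _"] cong: if_cong)
    then have "?dot w (column i B) \<in> valuation_ring nv" for i
      using w by (auto simp: dual_lattice_def)
    then show "w \<in> lattice_span nv (\<lambda>j. column j ?D)"
      unfolding lattice_span_def using dual[of w, symmetric]
      by (intro CollectI exI[of _ "\<lambda>i. ?dot w (column i B)"] conjI allI)
  next
    fix w assume "w \<in> lattice_span nv (\<lambda>j. column j ?D)"
    then obtain c where c: "w = (\<Sum>i\<in>UNIV. c i *s column i ?D)" "\<And>i. c i \<in> valuation_ring nv"
      unfolding lattice_span_def by blast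
    have "?dot w v \<in> valuation_ring nv" if v: "v \<in> lattice_span nv (\<lambda>j. column j B)" for v
    proof -
      obtain a where a: "v = (\<Sum>i\<in>UNIV. a i *s column i B)" "\<And>i. a i \<in> valuation_ring nv"
        using v unfolding lattice_span_def by blast
      \<comment> \<open>Here c_i = w \<bullet> b_i, and the valuation ring is closed under sums of
        products.\<close>
      have "?dot w v = (\<Sum>i\<in>UNIV. a i * c i)"
        unfolding a(1) dot by (simp only: c(1) dual_basis_coefficient[OF assms])
      then show ?thesis using a(2) c(2) by (simp only: sum_mult_in_valuation_ring)
    qed
    then show "w \<in> dual_lattice nv (lattice_span nv (\<lambda>j. column j B))"
      by (simp add: dual_lattice_def)
  qed
qed

section \<open>Orthogonality of the dual basis\<close>

lemma (in nonarch_abs) orthogonal_basis_dual: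
  fixes B :: "'k ^ 'n ^ 'n"
  assumes "orthogonal_basis nv (max_norm nv) \<Lambda> (\<lambda>j. column j B)"
  shows "orthogonal_basis nv (max_norm nv) (dual_lattice nv \<Lambda>)
    (\<lambda>j. column j (transpose (matrix_inv B)))"
proof -
  let ?M = "max_norm nv"
  let ?D = "transpose (matrix_inv B)"
  have inv: "invertible B" and \<Lambda>: "\<Lambda> = lattice_span nv (\<lambda>j. column j B)"
    and orth: "\<And>a. ?M (\<Sum>i\<in>UNIV. a i *s column i B) = Max (range (\<lambda>i. ?M (a i *s column i B)))"
    using assms by (auto simp: orthogonal_basis_def lattice_basis_def lin_indep_family_columns_iff)
  have "invertible ?D" using transpose_mult_dual[OF inv] invertible_def by blast
  then have basis: "lattice_basis nv (dual_lattice nv \<Lambda>) (\<lambda>j. column j ?D)"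
    by (simp only: lattice_basis_def lin_indep_family_columns_iff \<Lambda> dual_lattice_span_columns[OF inv])
  have D_B_le: "?M (column i ?D) * ?M (column i B) \<le> 1" for i
  proof -
    \<comment> \<open>The bounds below divide by M(b_i), which is positive because a column of an
      invertible matrix is nonzero.\<close>
    have pos: "0 < ?M (column i B)"
    proof (rule max_norm_pos)
      show "column i B \<noteq> 0"
        using inv[folded lin_indep_family_columns_iff] vec.dependent_zero
        by (metis lin_indep_family_def rangeI)
    qed
    have "nv (column i ?D $ l) \<le> 1 / ?M (column i B)" for l
    proof -
      \<comment> \<open>Row \<open>l\<close> of \<open>?D\<close> is column \<open>l\<close> of the
        inverse of \<open>B\<close>, hence the coordinate vector of e_l in the basis b_i.\<close>
      have "(\<Sum>i\<in>UNIV. (?D $ l $ i) *s column i B) = B *v (matrix_inv B *v axis l 1)"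
        unfolding sum_scale_column
        by (rule arg_cong[of _ _ "(*v) B"])
          (simp add: vec_eq_iff matrix_vector_mult_def axis_def transpose_def if_distrib cong: if_cong)
      also have "\<dots> = axis l 1"
        by (simp add: matrix_vector_mul_assoc matrix_mult_matrix_inv[OF inv])
      finally have "(\<Sum>i\<in>UNIV. (?D $ l $ i) *s column i B) = axis l 1" .
      \<comment> \<open>Orthogonality excludes cancellation, so no term of this expansion exceeds
        M(e_l).\<close>
      with orth[of "\<lambda>i. ?D $ l $ i"] have "Max (range (\<lambda>i. ?M ((?D $ l $ i) *s column i B))) \<le> 1"
        using max_norm_axis[of l] by simp
      then have "?M ((?D $ l $ i) *s column i B) \<le> 1" by simp
      then show ?thesis using pos by (simp add: max_norm_smult column_def field_simps)
    qed
    then have "?M (column i ?D) \<le> 1 / ?M (column i B)" by (simp add: max_norm_le_iff)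
    then show ?thesis using pos by (simp add: field_simps)
  qed
  have "?M (\<Sum>i\<in>UNIV. a i *s column i ?D) = Max (range (\<lambda>i. ?M (a i *s column i ?D)))" for a
  proof (rule antisym)
    show "?M (\<Sum>i\<in>UNIV. a i *s column i ?D) \<le> Max (range (\<lambda>i. ?M (a i *s column i ?D)))"
      by (rule max_norm_sum_le) simp
    let ?w = "\<Sum>i\<in>UNIV. a i *s column i ?D"
    have "?M (a j *s column j ?D) \<le> ?M ?w" for j
    proof -
      have "nv (a j) \<le> ?M ?w * ?M (column j B)"
        using nv_dot_le[of ?w "column j B"] by (simp only: dual_basis_coefficient[OF inv])
      \<comment> \<open>The factor M(d_j) is introduced so that \<open>D_B_le\<close> absorbs
        M(b_j).\<close>
      then have "nv (a j) * ?M (column j ?D) \<le> ?M ?w * ?M (column j B) * ?M (column j ?D)"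
        by (rule mult_right_mono) (rule max_norm_nonneg)
      also have "\<dots> = ?M ?w * (?M (column j ?D) * ?M (column j B))" by simp
      also have "\<dots> \<le> ?M ?w * 1"
        by (intro mult_left_mono D_B_le max_norm_nonneg)
      finally show ?thesis by (simp add: max_norm_smult)
    qed
    then show "Max (range (\<lambda>i. ?M (a i *s column i ?D))) \<le> ?M ?w" by simp
  qed
  then show ?thesis using basis by (simp add: orthogonal_basis_def)
qed

section \<open>The two ground fields\<close>

lemma padic_int_abs_nonneg: "0 \<le> padic_int_abs x"
  by (simp add: padic_int_abs_def)

text \<open>With m the smaller valuation, the residues of \<open>x\<close> and \<open>y\<close>
  modulo p^m vanish, hence so does that of the sum, whose valuation is then at least m.\<close>

lemma padic_int_abs_add_le_max:
  "padic_int_abs (x + y) \<le> max (padic_int_abs x) (padic_int_abs (y :: 'p::prime_card padic_int))"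
\<comment> \<open>The characterization \<open>padic_int_val_iff\<close> holds only for nonzero
  elements, so zeros are treated apart.\<close>
proof (cases "x = 0 \<or> y = 0 \<or> x + y = 0")
  case True
  then show ?thesis using padic_int_abs_nonneg[of x] by (auto simp: padic_int_abs_def le_max_iff_disj)
next
  case False
  let ?m = "min (padic_int_val x) (padic_int_val y)"
  have p: "real CARD('p) > 1" using prime_gt_1_nat[OF prime_card[where 'a='p]] by simp
  have "Rep_padic_int x ?m = 0" "Rep_padic_int y ?m = 0"
    using False by (simp_all add: padic_int_val_iff)
  then have "Rep_padic_int (x + y) ?m = 0" by (simp add: plus_padic_int.rep_eq)
  then have "?m \<le> padic_int_val (x + y)" using False by (simp add: padic_int_val_iff)
  then have "padic_int_val x \<le> padic_int_val (x + y) \<or> padic_int_val y \<le> padic_int_val (x + y)"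
    by linarith
  then show ?thesis using False p
    by (auto simp: padic_int_abs_def le_max_iff_disj frac_le power_increasing)
qed

text \<open>Each law reduces to numerators and denominators. For sums, a common denominator is used,
  and division by its positive absolute value commutes with the maximum.\<close>

lemma nonarch_abs_padic: "nonarch_abs (padic_abs :: 'p::prime_card padic \<Rightarrow> real)"
proof
  fix x y :: "'p padic"
  obtain a b where x: "x = Fract a b" and b: "b \<noteq> 0" by (cases x) auto
  obtain c d where y: "y = Fract c d" and d: "d \<noteq> 0" by (cases y) auto
  let ?N = "padic_int_abs :: 'p padic_int \<Rightarrow> real"
  have pos: "0 < ?N b" "0 < ?N d"
    using b d padic_int_abs_nonneg by (simp_all add: less_le)
  show "0 \<le> padic_abs x"
    using b by (simp add: x padic_abs_Fract padic_int_abs_nonneg)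
  show "padic_abs x = 0 \<longleftrightarrow> x = 0"
    using b by (simp add: x padic_abs_Fract Zero_fract_def eq_fract)
  show "padic_abs (x * y) = padic_abs x * padic_abs y"
    using b d by (simp add: x y padic_abs_Fract padic_int_abs_mult)
  have "padic_abs (x + y) = ?N (a * d + c * b) / (?N b * ?N d)"
    using b d by (simp add: x y padic_abs_Fract padic_int_abs_mult)
  also have "\<dots> \<le> max (?N (a * d)) (?N (c * b)) / (?N b * ?N d)"
    using pos by (intro divide_right_mono padic_int_abs_add_le_max) simp
  also have "\<dots> = max (padic_abs x) (padic_abs y)"
    using b d pos by (auto simp: x y padic_abs_Fract padic_int_abs_mult max_def field_simps)
  finally show "padic_abs (x + y) \<le> max (padic_abs x) (padic_abs y)" .
qed

text \<open>Subdegrees add under multiplication, and that of a nonzero sum is at least the minimum.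
  As p > 1, the negated exponent reverses the order.\<close>

lemma nonarch_abs_fp_laurent: "nonarch_abs (fp_laurent_abs :: 'p::prime_card fp_laurent \<Rightarrow> real)"
proof
  fix f g :: "'p fp_laurent"
  have p: "real CARD('p) > 1" using prime_gt_1_nat[OF prime_card[where 'a='p]] by simp
  show "0 \<le> fp_laurent_abs f" by (simp add: fp_laurent_abs_def)
  show "fp_laurent_abs f = 0 \<longleftrightarrow> f = 0" using p by (simp add: fp_laurent_abs_def)
  show "fp_laurent_abs (f * g) = fp_laurent_abs f * fp_laurent_abs g"
    using p by (simp add: fp_laurent_abs_def power_int_add[symmetric])
  show "fp_laurent_abs (f + g) \<le> max (fp_laurent_abs f) (fp_laurent_abs g)"
  \<comment> \<open>The subdegree of 0 is 0 by convention, not infinity, so zeros are treated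
    apart.\<close>
  proof (cases "f = 0 \<or> g = 0 \<or> f + g = 0")
    case True
    then show ?thesis by (auto simp: fp_laurent_abs_def le_max_iff_disj)
  next
    case False
    then have "fls_subdegree f \<le> fls_subdegree (f + g) \<or> fls_subdegree g \<le> fls_subdegree (f + g)"
      using fls_plus_subdegree[of f g] by linarith
    then show ?thesis using False p
      by (auto simp: fp_laurent_abs_def le_max_iff_disj power_int_increasing)
  qed
qed

theorem theorem2p3:
  shows "(\<forall>(\<Lambda> :: ('p::prime_card padic ^ 'n) set) (B :: 'p padic ^ 'n ^ 'n) D.
            full_rank_lattice padic_abs \<Lambda> \<and>
            lattice_basis padic_abs \<Lambda> (\<lambda>j. column j B) \<and>
            D = transpose (matrix_inv B) \<and>
            orthogonal_basis padic_abs (max_norm padic_abs) \<Lambda> (\<lambda>j. column j B)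
            \<longrightarrow> orthogonal_basis padic_abs (max_norm padic_abs)
                  (dual_lattice padic_abs \<Lambda>) (\<lambda>j. column j D))
       \<and> (\<forall>(\<Lambda> :: ('p::prime_card fp_laurent ^ 'n) set) (B :: 'p fp_laurent ^ 'n ^ 'n) D.
            full_rank_lattice fp_laurent_abs \<Lambda> \<and>
            lattice_basis fp_laurent_abs \<Lambda> (\<lambda>j. column j B) \<and>
            D = transpose (matrix_inv B) \<and>
            orthogonal_basis fp_laurent_abs (max_norm fp_laurent_abs) \<Lambda> (\<lambda>j. column j B)
            \<longrightarrow> orthogonal_basis fp_laurent_abs (max_norm fp_laurent_abs)
                  (dual_lattice fp_laurent_abs \<Lambda>) (\<lambda>j. column j D))"
  using nonarch_abs.orthogonal_basis_dual[OF nonarch_abs_padic]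
    nonarch_abs.orthogonal_basis_dual[OF nonarch_abs_fp_laurent] by blast

end
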